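(* Let $\lambda=(\lambda_0,\dots,\lambda_{d-1})\in\mathbb{C}^d$, let $k$ be an index with $|\lambda_k|=\|\lambda\|_\infty$, and suppose that $\lambda_k$ is real and positive. Let $\beta_{\tau(j,m)}=\lambda_j\overline{\lambda_m}$ for $j,m\in\{0,\dots,d-1\}$, and let $\tilde\beta\in\mathbb{C}^{d^2}$ satisfy $\|\tilde\beta-\beta\|_\infty\le\delta$. Estimate $\lambda$ by $\tilde\lambda=(\tilde\lambda_0,\dots,\tilde\lambda_{d-1})$, where $$|\tilde\lambda_j|:=\sqrt{|\tilde\beta_{\tau(j,j)}|},\qquad \tilde\lambda_j:=\frac{\tilde\beta_{\tau(j,k)}}{|\tilde\beta_{\tau(j,k)}|}\,|\tilde\lambda_j|.$$ If $\delta<\|\lambda\|_{-\infty}^2$, then $$\|\tilde\lambda-\lambda\|_\infty\le\Bigl(\frac{2\sqrt2}{\|\lambda\|_{-\infty}}+\frac{1}{2\sqrt{\|\lambda\|_{-\infty}^2-\delta}}\Bigr)\,\delta,$$ and, for $\delta\le\|\lambda\|_{-\infty}^2/2$, in particular $$\|\tilde\lambda-\lambda\|_\infty\le\frac{5\sqrt2\,\delta}{2\|\lambda\|_{-\infty}}.$$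
   Context: $\|\lambda\|_\infty=\max_j|\lambda_j|$ and $\|\lambda\|_{-\infty}:=\min_j|\lambda_j|$. $\tau$ is a bijection $\{0,\dots,d-1\}^2\to\{0,\dots,d^2-1\}$ labelling the products. *)

theory Defs
  imports Complex_Main "Jordan_Normal_Form.Matrix"
begin

text \<open>Vectors in \<open>\<complex>\<^sup>d\<close> are elements of \<^term>\<open>carrier_vec d :: complex vec set\<close>, indexed from \<open>0\<close>.
  Both quantities below are unspecified for the empty vector.\<close>

definition linf_norm :: "complex vec \<Rightarrow> real" ("\<parallel>_\<parallel>\<^sub>\<infinity>") where
  "\<parallel>v\<parallel>\<^sub>\<infinity> = Max {cmod (v $ j) |j. j < dim_vec v}"

definition lminf_norm :: "complex vec \<Rightarrow> real" ("\<parallel>_\<parallel>\<^sub>-\<^sub>\<infinity>") where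
  "\<parallel>v\<parallel>\<^sub>-\<^sub>\<infinity> = Min {cmod (v $ j) |j. j < dim_vec v}"

definition est_modulus :: "(nat \<times> nat \<Rightarrow> nat) \<Rightarrow> complex vec \<Rightarrow> nat \<Rightarrow> real" where
  "est_modulus \<tau> b j = sqrt (cmod (b $ \<tau> (j, j)))"

text \<open>If \<open>b $ \<tau> (j, k) = 0\<close>, the phase below is undefined in ordinary mathematics; here the
  convention \<open>x / 0 = 0\<close> makes the entry \<open>0\<close>.\<close>

definition estimate :: "nat \<Rightarrow> (nat \<times> nat \<Rightarrow> nat) \<Rightarrow> nat \<Rightarrow> complex vec \<Rightarrow> complex vec" where
  "estimate d \<tau> k b = vec d (\<lambda>j.
     b $ \<tau> (j, k) / complex_of_real (cmod (b $ \<tau> (j, k))) * complex_of_real (est_modulus \<tau> b j))"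

end

(* The error in entry j splits into a modulus error and |lambda_j| times a phase error.
   The former is | |b_jj| - |lambda_j|^2 | / (|~lambda_j| + |lambda_j|), where both summands of the
   denominator are at least sqrt (min^2 - delta).  Normalising a vector w after perturbing it by e
   moves w / |w| by at most 2 |e| / |w|; for w = lambda_j lambda_k this gives a phase contribution of
   at most 2 delta / |lambda_k|, so the factor 2 sqrt 2 of the theorem is not sharp. *)
theory Submission
  imports Defs
begin

lemma cmod_index_le_linf_norm:
  assumes "j < dim_vec v"
  shows "cmod (v $ j) \<le> \<parallel>v\<parallel>\<^sub>\<infinity>"
  unfolding linf_norm_def by (rule Max_ge) (use assms in auto)

lemma lminf_norm_le_cmod_index:
  assumes "j < dim_vec v"
  shows "\<parallel>v\<parallel>\<^sub>-\<^sub>\<infinity> \<le> cmod (v $ j)"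
  unfolding lminf_norm_def by (rule Min_le) (use assms in auto)

lemma linf_norm_leI:
  assumes "0 < dim_vec v" and "\<And>j. j < dim_vec v \<Longrightarrow> cmod (v $ j) \<le> c"
  shows "\<parallel>v\<parallel>\<^sub>\<infinity> \<le> c"
  unfolding linf_norm_def by (rule Max.boundedI) (use assms in auto)

lemma lminf_norm_attained:
  assumes "0 < dim_vec v"
  obtains j where "j < dim_vec v" "\<parallel>v\<parallel>\<^sub>-\<^sub>\<infinity> = cmod (v $ j)"
proof -
  have "Min {cmod (v $ j) |j. j < dim_vec v} \<in> {cmod (v $ j) |j. j < dim_vec v}"
    by (rule Min_in) (use assms in auto)
  then show thesis using that unfolding lminf_norm_def by blast
qed

text \<open>Compare both unit vectors with the intermediate point \<open>z / cmod w\<close>.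
  Rescaling \<open>z\<close> from length \<open>cmod z\<close> to \<open>cmod w\<close> costs
  \<open>\<bar>cmod w - cmod z\<bar> / cmod w\<close>, which the reverse triangle inequality bounds
  by the other cost, \<open>cmod (z - w) / cmod w\<close>. Only the unperturbed \<open>w\<close>
  enters the denominator.\<close>

lemma norm_normalize_diff_le:
  fixes z w :: complex
  assumes "w \<noteq> 0" "z \<noteq> 0"
  shows "cmod (z / cmod z - w / cmod w) \<le> 2 * cmod (z - w) / cmod w"
proof -
  have split: "z / cmod z - w / cmod w = (z / cmod z) * of_real ((cmod w - cmod z) / cmod w) + (z - w) / cmod w"
    using assms by (simp add: field_simps)
  have "cmod (z / cmod z - w / cmod w)
      \<le> cmod ((z / cmod z) * of_real ((cmod w - cmod z) / cmod w)) + cmod ((z - w) / cmod w)"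
    unfolding split by (rule norm_triangle_ineq)
  also have "\<dots> = \<bar>cmod w - cmod z\<bar> / cmod w + cmod (z - w) / cmod w"
    using assms by (simp add: norm_mult norm_divide del: of_real_divide of_real_diff)
  also have "\<dots> \<le> cmod (z - w) / cmod w + cmod (z - w) / cmod w"
    using norm_triangle_ineq3[of w z]
    by (intro add_right_mono divide_right_mono) (simp_all add: norm_minus_commute)
  finally show ?thesis by simp
qed

text \<open>Meant for \<open>x\<close> a perturbed diagonal entry in modulus, \<open>a\<close> the
  modulus to recover and \<open>c\<close> a lower bound for it. The third hypothesis forces \<delta>
  to be nonnegative, so \<open>c\<^sup>2 - \<delta>\<close> bounds \<open>a\<^sup>2\<close> as well
  as \<open>x\<close> from below.\<close>

lemma abs_sqrt_diff_le:
  fixes a c x \<delta> :: real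
  assumes "0 \<le> a" "c\<^sup>2 \<le> a\<^sup>2" "\<bar>x - a\<^sup>2\<bar> \<le> \<delta>" "\<delta> < c\<^sup>2"
  shows "\<bar>sqrt x - a\<bar> \<le> \<delta> / (2 * sqrt (c\<^sup>2 - \<delta>))"
proof -
  let ?s = "sqrt (c\<^sup>2 - \<delta>)"
  have x: "0 \<le> x" using assms by linarith
  have s: "0 < ?s" using assms by simp
  have "?s \<le> sqrt x" using assms by (intro real_sqrt_le_mono) linarith
  moreover have "?s \<le> sqrt (a\<^sup>2)" using assms by (intro real_sqrt_le_mono) linarith
  ultimately have ge: "2 * ?s \<le> sqrt x + a"
    unfolding real_sqrt_unique[OF refl assms(1)] by linarith
  have "\<bar>sqrt x - a\<bar> * (2 * ?s) \<le> \<bar>sqrt x - a\<bar> * (sqrt x + a)"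
    using ge by (intro mult_left_mono) auto
  also have "\<dots> = \<bar>(sqrt x - a) * (sqrt x + a)\<bar>"
    using x assms(1) by (simp add: abs_mult)
  also have "(sqrt x - a) * (sqrt x + a) = x - a\<^sup>2"
    using x by (simp add: algebra_simps power2_eq_square)
  finally show ?thesis using assms(3) s by (simp add: pos_le_divide_eq)
qed

theorem proposition9p16:
  fixes d k :: nat
    and l \<beta> \<beta>' :: "complex vec"
    and \<tau> :: "nat \<times> nat \<Rightarrow> nat"
    and \<delta> :: real
  assumes "bij_betw \<tau> ({0..<d} \<times> {0..<d}) {0..<d^2}"
    and "l \<in> carrier_vec d"
    and "k < d"
    and "cmod (l $ k) = \<parallel>l\<parallel>\<^sub>\<infinity>"
    and "l $ k \<in> \<real>"
    and "Re (l $ k) > 0"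
    and "\<beta> \<in> carrier_vec (d^2)"
    and "\<And>j m. j < d \<Longrightarrow> m < d \<Longrightarrow> \<beta> $ \<tau> (j, m) = l $ j * cnj (l $ m)"
    and "\<beta>' \<in> carrier_vec (d^2)"
    and "\<parallel>\<beta>' - \<beta>\<parallel>\<^sub>\<infinity> \<le> \<delta>"
    and "\<delta> < \<parallel>l\<parallel>\<^sub>-\<^sub>\<infinity>^2"
  shows "\<parallel>estimate d \<tau> k \<beta>' - l\<parallel>\<^sub>\<infinity>
           \<le> (2 * sqrt 2 / \<parallel>l\<parallel>\<^sub>-\<^sub>\<infinity> + 1 / (2 * sqrt (\<parallel>l\<parallel>\<^sub>-\<^sub>\<infinity>^2 - \<delta>))) * \<delta>
       \<and> (\<delta> \<le> \<parallel>l\<parallel>\<^sub>-\<^sub>\<infinity>^2 / 2 \<longrightarrow>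
            \<parallel>estimate d \<tau> k \<beta>' - l\<parallel>\<^sub>\<infinity> \<le> 5 * sqrt 2 * \<delta> / (2 * \<parallel>l\<parallel>\<^sub>-\<^sub>\<infinity>))"
proof -
  define m where "m = \<parallel>l\<parallel>\<^sub>-\<^sub>\<infinity>"
  have dim: "dim_vec l = d" "dim_vec \<beta> = d\<^sup>2" "dim_vec \<beta>' = d\<^sup>2"
    using assms(2,7,9) by auto
  have m_le: "m \<le> cmod (l $ j)" if "j < d" for j
    using lminf_norm_le_cmod_index that dim unfolding m_def by simp
  \<comment> \<open>The index \<open>k\<close> makes \<open>l\<close> nonempty, so the minimum is
    one of the moduli.\<close>
  have m_nonneg: "0 \<le> m"
    using lminf_norm_attained[of l] assms(3) dim unfolding m_def by fastforce
  have \<tau>_less: "\<tau> (i, j) < d\<^sup>2" if "i < d" "j < d" for i j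
    using bij_betwE[OF assms(1)] that by auto
  have err: "cmod (\<beta>' $ \<tau> (i, j) - l $ i * cnj (l $ j)) \<le> \<delta>" if "i < d" "j < d" for i j
    using cmod_index_le_linf_norm[of "\<tau> (i, j)" "\<beta>' - \<beta>"] \<tau>_less[OF that] assms(8)[OF that]
      assms(10) dim by simp
  \<comment> \<open>The sign of \<delta> comes from its bounding an actual error, here that of the
    diagonal entry at \<open>k\<close>.\<close>
  have \<delta>_nonneg: "0 \<le> \<delta>"
    using err[OF assms(3) assms(3)] norm_ge_zero order_trans by blast
  have \<delta>_less: "\<delta> < m\<^sup>2" using assms(11) by (simp add: m_def)
  \<comment> \<open>If \<open>m\<close> were zero, \<delta> would be negative.\<close>
  then have m_pos: "0 < m" using \<delta>_nonneg m_nonneg by (cases "m = 0") auto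
  define A where "A = cmod (l $ k)"
  have lk: "l $ k = of_real A"
    using assms(5,6) unfolding A_def by (auto elim!: Reals_cases)
  have A: "m \<le> A" using m_le[OF assms(3)] by (simp add: A_def)
  have entry: "cmod ((estimate d \<tau> k \<beta>' - l) $ j)
      \<le> 2 * \<delta> / m + \<delta> / (2 * sqrt (m\<^sup>2 - \<delta>))" if j: "j < d" for j
  proof -
    define a where "a = cmod (l $ j)"
    define z where "z = \<beta>' $ \<tau> (j, k)"
    define w where "w = l $ j * cnj (l $ k)"
    define r where "r = est_modulus \<tau> \<beta>' j"
    have a: "m \<le> a" using m_le[OF j] by (simp add: a_def)
    have cw: "cmod w = a * A" by (simp add: w_def a_def A_def norm_mult)
    have zw: "cmod (z - w) \<le> \<delta>" using err[OF j assms(3)] by (simp add: z_def w_def)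
    \<comment> \<open>This puts \<open>w\<close> farther than \<delta> from the origin, so
      \<open>z\<close> cannot vanish and the convention for division by zero is never met.\<close>
    have "m\<^sup>2 \<le> a * A" unfolding power2_eq_square using a A m_pos by (intro mult_mono) auto
    then have "\<delta> < cmod w" using cw \<delta>_less by simp
    then have w0: "w \<noteq> 0" and z0: "z \<noteq> 0" using \<delta>_nonneg zw by auto
    \<comment> \<open>Since \<open>l $ k\<close> is the positive number \<open>A\<close>, the
      product \<open>w\<close> has exactly the phase of \<open>l $ j\<close>; this fixes the global
      phase.\<close>
    have lj: "l $ j = w / cmod w * a"
      using w0 a A m_pos unfolding cw by (simp add: w_def lk)
    have "(estimate d \<tau> k \<beta>' - l) $ j = z / cmod z * r - l $ j"
      using j dim by (simp add: estimate_def z_def r_def)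
    \<comment> \<open>The modulus error carries the unimodular factor \<open>z / cmod z\<close>, the
      phase error the true modulus \<open>a\<close>.\<close>
    also have "\<dots> = z / cmod z * of_real (r - a) + (z / cmod z - w / cmod w) * a"
      by (subst lj) (simp add: algebra_simps diff_divide_distrib)
    finally have "cmod ((estimate d \<tau> k \<beta>' - l) $ j)
        \<le> cmod (z / cmod z * of_real (r - a)) + cmod ((z / cmod z - w / cmod w) * a)"
      by (simp only: norm_triangle_ineq)
    also have "\<dots> = \<bar>r - a\<bar> + cmod (z / cmod z - w / cmod w) * a"
      using z0 a m_pos by (simp add: norm_mult norm_divide del: of_real_diff)
    finally have split: "cmod ((estimate d \<tau> k \<beta>' - l) $ j)
        \<le> \<bar>r - a\<bar> + cmod (z / cmod z - w / cmod w) * a" .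
    have "cmod (z / cmod z - w / cmod w) * a \<le> 2 * cmod (z - w) / cmod w * a"
      using norm_normalize_diff_le[OF w0 z0] a m_pos by (intro mult_right_mono) auto
    \<comment> \<open>The weight \<open>a\<close> cancels against \<open>cmod w = a * A\<close>, so
      a large entry does not amplify its phase error.\<close>
    also have "\<dots> = 2 * cmod (z - w) / A"
      using a m_pos by (simp add: cw)
    also have "\<dots> \<le> 2 * \<delta> / m"
      using zw A m_pos \<delta>_nonneg by (intro frac_le) auto
    finally have phase: "cmod (z / cmod z - w / cmod w) * a \<le> 2 * \<delta> / m" .
    have "cmod (l $ j * cnj (l $ j)) = a\<^sup>2"
      by (simp add: a_def norm_mult power2_eq_square)
    then have "\<bar>cmod (\<beta>' $ \<tau> (j, j)) - a\<^sup>2\<bar> \<le> \<delta>"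
      using err[OF j j] norm_triangle_ineq3[of "\<beta>' $ \<tau> (j, j)" "l $ j * cnj (l $ j)"] by simp
    then have "\<bar>r - a\<bar> \<le> \<delta> / (2 * sqrt (m\<^sup>2 - \<delta>))"
      unfolding r_def est_modulus_def
      using a m_pos \<delta>_less by (intro abs_sqrt_diff_le) (auto intro: power_mono)
    with split phase show ?thesis by linarith
  qed
  have dim_diff: "dim_vec (estimate d \<tau> k \<beta>' - l) = d" using dim by simp
  have sqrt2: "1 \<le> sqrt 2" by simp
  have "\<parallel>estimate d \<tau> k \<beta>' - l\<parallel>\<^sub>\<infinity> \<le> 2 * \<delta> / m + \<delta> / (2 * sqrt (m\<^sup>2 - \<delta>))"
    using entry assms(3) dim_diff by (intro linf_norm_leI) auto
  \<comment> \<open>Weakening to the stated constant.\<close>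
  also have "2 * \<delta> / m \<le> 2 * sqrt 2 * \<delta> / m"
    using sqrt2 \<delta>_nonneg m_pos by (intro divide_right_mono mult_right_mono) auto
  finally have main: "\<parallel>estimate d \<tau> k \<beta>' - l\<parallel>\<^sub>\<infinity>
      \<le> (2 * sqrt 2 / m + 1 / (2 * sqrt (m\<^sup>2 - \<delta>))) * \<delta>"
    by (simp add: algebra_simps)
  moreover have "\<parallel>estimate d \<tau> k \<beta>' - l\<parallel>\<^sub>\<infinity> \<le> 5 * sqrt 2 * \<delta> / (2 * m)"
    if "\<delta> \<le> m\<^sup>2 / 2"
  proof -
    \<comment> \<open>For \<delta> at most half of \<open>m\<^sup>2\<close> the root stays above
      \<open>m / sqrt 2\<close>. The modulus term then contributes \<open>sqrt 2 / 2\<close>, which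
      with \<open>2 * sqrt 2\<close> adds up to \<open>5 * sqrt 2 / 2\<close>.\<close>
    have "m / sqrt 2 = sqrt (m\<^sup>2 / 2)"
      using m_pos by (simp add: real_sqrt_divide)
    also have "\<dots> \<le> sqrt (m\<^sup>2 - \<delta>)"
      using that by (intro real_sqrt_le_mono) linarith
    finally have "1 / (2 * sqrt (m\<^sup>2 - \<delta>)) \<le> 1 / (2 * (m / sqrt 2))"
      using m_pos by (intro divide_left_mono) (auto intro!: mult_pos_pos simp: \<delta>_less)
    also have "\<dots> = sqrt 2 / (2 * m)" by simp
    finally have "(2 * sqrt 2 / m + 1 / (2 * sqrt (m\<^sup>2 - \<delta>))) * \<delta>
        \<le> (2 * sqrt 2 / m + sqrt 2 / (2 * m)) * \<delta>"
      using \<delta>_nonneg by (intro mult_right_mono) auto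
    also have "\<dots> = 5 * sqrt 2 * \<delta> / (2 * m)"
      using m_pos by (simp add: field_simps)
    finally show ?thesis using main by linarith
  qed
  ultimately show ?thesis unfolding m_def by blast
qed

end
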